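(* Let $\mathcal{G}=\{\mathcal{N},\mathcal{L},\boldsymbol{w}\}$ be a connected weighted graph with $N$ vertices whose edge weights are independent (not necessarily identically distributed) continuous random variables strictly bounded away from zero from below, and let $\boldsymbol{B}\in\mathbb{R}^{N\times N}$ be its Laplacian. Then any $N'\times N''$ submatrix of $\boldsymbol{B}$ (formed by choosing $N'$ rows and $N''$ columns) with $\min(N',N'')\le N-1$ has rank $\min(N',N'')$ with probability one if it has structural rank $\min(N',N'')$.
   Context: The Laplacian of a weighted graph has $\boldsymbol{B}_{ij}=-w_{ij}$ if $i\neq j$ are joined by an edge of weight $w_{ij}>0$, $\boldsymbol{B}_{ij}=0$ if $i\ne j$ are not joined by an edge, and $\boldsymbol{B}_{ii}=\sum_{j\ne i}w_{ij}$. A set of independent entries of a matrix $\boldsymbol{H}$ is a set of nonzero entries no two of which lie in the same row or the same column. The structural rank of $\boldsymbol{H}$ is the maximum number of elements in a set of independent entries of $\boldsymbol{H}$. Since the positions of the nonzero entries of $\boldsymbol{B}$ are determined by the graph, the structural rank of a submatrix is deterministic. *)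

theory Defs
  imports "HOL-Probability.Probability" "Jordan_Normal_Form.DL_Rank_Submatrix"
begin

(* Graphs are simple and undirected on the vertices 0, ..., N - 1; an edge is the two-element
   set of its endpoints, so the weight of an edge is symmetric by construction. *)

definition simple_graph :: "nat \<Rightarrow> nat set set \<Rightarrow> bool" where
  "simple_graph N E \<longleftrightarrow> E \<subseteq> {{i, j} | i j. i < N \<and> j < N \<and> i \<noteq> j}"

definition connected_graph :: "nat \<Rightarrow> nat set set \<Rightarrow> bool" where
  "connected_graph N E \<longleftrightarrow>
     0 < N \<and> simple_graph N E \<and> (\<forall>i<N. \<forall>j<N. (i, j) \<in> {(u, v). {u, v} \<in> E}\<^sup>*)"

definition laplacian :: "nat \<Rightarrow> nat set set \<Rightarrow> (nat set \<Rightarrow> real) \<Rightarrow> real mat" where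
  "laplacian N E w = mat N N (\<lambda>(i, j).
     if i = j then (\<Sum>k | k < N \<and> k \<noteq> i \<and> {i, k} \<in> E. w {i, k})
     else if {i, j} \<in> E then - w {i, j}
     else 0)"

definition independent_entries :: "'a::zero mat \<Rightarrow> (nat \<times> nat) set \<Rightarrow> bool" where
  "independent_entries A S \<longleftrightarrow>
     S \<subseteq> {0..<dim_row A} \<times> {0..<dim_col A} \<and> (\<forall>p\<in>S. A $$ p \<noteq> 0) \<and>
     (\<forall>p\<in>S. \<forall>q\<in>S. p \<noteq> q \<longrightarrow> fst p \<noteq> fst q \<and> snd p \<noteq> snd q)"

definition structural_rank :: "'a::zero mat \<Rightarrow> nat" where
  "structural_rank A = Max {card S | S. independent_entries A S}"

abbreviation mat_rank :: "'a::field mat \<Rightarrow> nat" where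
  "mat_rank A \<equiv> vec_space.rank (dim_row A) A"

(* Continuity is continuity of the distribution function, i.e. the distribution has no atoms;
   in particular this covers every random variable that has a density. *)

definition continuous_rv :: "'a measure \<Rightarrow> ('a \<Rightarrow> real) \<Rightarrow> bool" where
  "continuous_rv M X \<longleftrightarrow>
     X \<in> borel_measurable M \<and> continuous_on UNIV (cdf (distr M borel X))"

definition bounded_away_from_zero :: "'a measure \<Rightarrow> ('a \<Rightarrow> real) \<Rightarrow> bool" where
  "bounded_away_from_zero M X \<longleftrightarrow> (\<exists>\<epsilon>>0. AE \<omega> in M. \<epsilon> \<le> X \<omega>)"

end

theory Submission imports Defs begin

text \<open>
  A minor of the Laplacian is a polynomial in the edge weights, so by independence and the absence
  of atoms it is almost surely nonzero as soon as it is nonzero for a single choice of real weights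
  (\<open>AE_coordinatewise_polynomial_nonzero\<close>). Finding such weights is the combinatorial core
  (\<open>laplacian_minor_trivial_kernel\<close>); \<open>0\<close> and \<open>1\<close> suffice as values.

  A full set of independent entries gives a bijection \<open>\<sigma>\<close> from a set \<open>I\<close> of rows to a set \<open>J\<close> of
  columns that moves each vertex along an edge or not at all. Following \<open>\<sigma>\<close> from the vertices outside
  \<open>J\<close> yields disjoint paths that end exactly in the vertices outside \<open>I\<close>, because the two complements
  have the same size; there is at least one path because the minor is proper. Every other vertex is hung
  onto these paths by a shortest path, which connectedness provides. The result is a spanning forest,
  rooted at the vertices outside \<open>J\<close>; its edges get weight \<open>1\<close>, all others weight \<open>0\<close>.

  Suppose that a vector vanishes outside \<open>J\<close> and is harmonic at every vertex of \<open>I\<close>. Harmonicity at a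
  leaf off the paths makes the vector constant along its parent edge; peeling off leaves, it is constant
  along all edges off the paths. Then harmonicity at the successive vertices of a path, starting at
  the root, where the vector is \<open>0\<close>, makes it vanish along the path. Hence it vanishes
  everywhere, and the minor at these weights is nonzero. In terms of the all-minors matrix tree theorem,
  this forest is one monomial of the minor; the kernel argument replaces the sign bookkeeping of
  that theorem.
\<close>

section \<open>Paths along a matching\<close>

text \<open>
  For a bijection \<open>\<sigma>\<close> defined on \<open>I\<close>, these are the vertices met when \<open>\<sigma>\<close> is iterated from \<open>W\<close> until
  it leaves \<open>I\<close>. An induction over this set walks along the paths from their first vertices.
\<close>
inductive_set path_vertices :: "('v \<Rightarrow> 'v) \<Rightarrow> 'v set \<Rightarrow> 'v set \<Rightarrow> 'v set"
  for \<sigma> :: "'v \<Rightarrow> 'v" and I W :: "'v set" where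
  start: "w \<in> W \<Longrightarrow> w \<in> path_vertices \<sigma> I W"
| step: "u \<in> path_vertices \<sigma> I W \<Longrightarrow> u \<in> I \<Longrightarrow> \<sigma> u \<in> path_vertices \<sigma> I W"

lemma path_vertices_subset:
  assumes "W \<subseteq> V" "\<sigma> ` I \<subseteq> V"
  shows "path_vertices \<sigma> I W \<subseteq> V"
proof
  fix v assume "v \<in> path_vertices \<sigma> I W"
  then show "v \<in> V" by induction (use assms in auto)
qed

text \<open>
  Each path starts outside \<open>J\<close> and can stop only outside \<open>I\<close>. The set \<open>Z\<close> of path vertices consists of
  \<open>V - J\<close> and the \<open>\<sigma>\<close>-image of \<open>Z \<inter> I\<close>, so counting gives \<open>card (Z - I) = card (V - J) = card (V - I)\<close>:
  the ends of the paths exhaust \<open>V - I\<close>. The count replaces following each path to its end.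
\<close>
lemma unmatched_on_paths:
  fixes V I J :: "'v set"
  assumes fin: "finite V" and sub: "I \<subseteq> V" "J \<subseteq> V" and bij: "bij_betw \<sigma> I J"
  shows "V - I \<subseteq> path_vertices \<sigma> I (V - J)"
proof -
  define Z where "Z = path_vertices \<sigma> I (V - J)"
  have im: "\<sigma> ` I = J" and inj: "inj_on \<sigma> I"
    using bij by (auto simp: bij_betw_def)
  have ZV: "Z \<subseteq> V" unfolding Z_def
    by (rule path_vertices_subset) (use im sub in auto)
  have finZ: "finite Z" using ZV fin finite_subset by blast
  have ZJ: "Z \<inter> J = \<sigma> ` (Z \<inter> I)"
  proof
    show "\<sigma> ` (Z \<inter> I) \<subseteq> Z \<inter> J"
      using im by (auto simp: Z_def intro: path_vertices.step)
    show "Z \<inter> J \<subseteq> \<sigma> ` (Z \<inter> I)"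
    proof
      fix z assume z: "z \<in> Z \<inter> J"
      then have "z \<in> path_vertices \<sigma> I (V - J)" by (simp add: Z_def)
      then show "z \<in> \<sigma> ` (Z \<inter> I)"
        by cases (use z in \<open>auto simp: Z_def\<close>)
    qed
  qed
  have "V - J \<subseteq> Z" by (auto simp: Z_def intro: path_vertices.start)
  then have "Z - J = V - J" using ZV by auto
  then have "card (V - J) = card Z - card (Z \<inter> J)"
    using card_Diff_subset_Int[of Z J] finZ by simp
  also have "card (Z \<inter> J) = card (Z \<inter> I)"
    unfolding ZJ by (rule card_image) (use inj in \<open>auto intro: inj_on_subset\<close>)
  also have "card Z - card (Z \<inter> I) = card (Z - I)"
    using card_Diff_subset_Int[of Z I] finZ by simp
  finally have "card (V - J) = card (Z - I)" .
  moreover have "card (V - I) = card (V - J)"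
    using bij_betw_same_card[OF bij] fin sub finite_subset[OF sub(1) fin] finite_subset[OF sub(2) fin]
    by (simp add: card_Diff_subset)
  ultimately have "Z - I = V - I"
    using ZV fin by (intro card_subset_eq) auto
  then show ?thesis by (auto simp: Z_def)
qed

lemma connected_graph_vertices:
  assumes "connected_graph N E" "{u, v} \<in> E"
  shows "u < N" "v < N" "u \<noteq> v"
proof -
  have "{u, v} \<in> {{i, j} | i j. i < N \<and> j < N \<and> i \<noteq> j}"
    using assms unfolding connected_graph_def simple_graph_def by blast
  then show "u < N" "v < N" "u \<noteq> v" by (auto simp: doubleton_eq_iff)
qed

text \<open>
  The function \<open>d\<close> is the distance to \<open>Z\<close> and \<open>p v\<close> the next vertex on a shortest path from \<open>v\<close> to \<open>Z\<close>.
\<close>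
lemma parents_towards_set:
  assumes conn: "connected_graph N E" and Z: "Z \<subseteq> {..<N}" "Z \<noteq> {}"
  obtains p and d :: "nat \<Rightarrow> nat"
  where "\<And>v. v < N \<Longrightarrow> v \<notin> Z \<Longrightarrow> {v, p v} \<in> E \<and> d (p v) < d v"
proof -
  define R where "R = {(u, v). {u, v} \<in> E}"
  define d where "d v = (LEAST n. \<exists>z\<in>Z. (v, z) \<in> R ^^ n)" for v
  have "\<exists>u. {v, u} \<in> E \<and> d u < d v" if v: "v < N" "v \<notin> Z" for v
  proof -
    obtain z0 where z0: "z0 \<in> Z" using Z by blast
    then have "(v, z0) \<in> R\<^sup>*"
      using conn v Z unfolding connected_graph_def R_def by blast
    then have "\<exists>n. \<exists>z\<in>Z. (v, z) \<in> R ^^ n"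
      using z0 rtrancl_imp_relpow by metis
    then have "\<exists>z\<in>Z. (v, z) \<in> R ^^ d v"
      unfolding d_def by (rule LeastI_ex)
    then obtain z where z: "z \<in> Z" "(v, z) \<in> R ^^ d v" by blast
    then obtain n where n: "d v = Suc n"
      using v by (cases "d v") auto
    then obtain u where u: "(v, u) \<in> R" "(u, z) \<in> R ^^ n"
      using z by (metis relpow_Suc_D2)
    have "d u \<le> n" unfolding d_def by (rule Least_le) (use u z in blast)
    then show ?thesis using u n by (auto simp: R_def)
  qed
  then obtain p where "\<And>v. v < N \<Longrightarrow> v \<notin> Z \<Longrightarrow> {v, p v} \<in> E \<and> d (p v) < d v"
    by metis
  then show thesis by (rule that)
qed

section \<open>Weights for which a minor does not vanish\<close>

lemma laplacian_row_sum:
  assumes i: "i < N"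
  shows "(\<Sum>j<N. laplacian N E w $$ (i, j) * x j) =
    (\<Sum>k | k < N \<and> k \<noteq> i \<and> {i, k} \<in> E. w {i, k} * (x i - x k))"
proof -
  define K where "K = {k. k < N \<and> k \<noteq> i \<and> {i, k} \<in> E}"
  have K: "finite K" "K \<subseteq> {..<N} - {i}" by (auto simp: K_def)
  have "(\<Sum>j<N. laplacian N E w $$ (i, j) * x j) =
      laplacian N E w $$ (i, i) * x i + (\<Sum>j\<in>{..<N} - {i}. laplacian N E w $$ (i, j) * x j)"
    using i by (simp add: sum.remove)
  also have "(\<Sum>j\<in>{..<N} - {i}. laplacian N E w $$ (i, j) * x j) = (\<Sum>k\<in>K. - w {i, k} * x k)"
    using i K by (intro sum.mono_neutral_cong_right) (auto simp: laplacian_def K_def)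
  also have "laplacian N E w $$ (i, i) = (\<Sum>k\<in>K. w {i, k})"
    using i by (simp add: laplacian_def K_def)
  finally show ?thesis
    by (simp add: K_def sum_distrib_right right_diff_distrib sum_subtractf sum_negf)
qed

text \<open>
  With the indicator of \<open>F\<close> as weights, the value of a harmonic function at \<open>i\<close> is the mean of its values
  at the neighbours along \<open>F\<close>, so if all neighbours but one agree with \<open>i\<close>, then so does the last one.
  This is the elimination step of the kernel argument.
\<close>
lemma harmonic_single_neighbour:
  fixes x :: "nat \<Rightarrow> real"
  assumes "(\<Sum>j<N. laplacian N E (\<lambda>e. of_bool (e \<in> F)) $$ (i, j) * x j) = 0"
    and "i < N" "k0 < N" "k0 \<noteq> i" "{i, k0} \<in> E" "{i, k0} \<in> F"
    and others: "\<And>k. k < N \<Longrightarrow> k \<noteq> i \<Longrightarrow> k \<noteq> k0 \<Longrightarrow> {i, k} \<in> F \<Longrightarrow> x k = x i"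
  shows "x k0 = x i"
proof -
  define K where "K = {k. k < N \<and> k \<noteq> i \<and> {i, k} \<in> E}"
  have K: "finite K" "k0 \<in> K" using assms by (auto simp: K_def)
  have "0 = (\<Sum>k\<in>K. of_bool ({i, k} \<in> F) * (x i - x k))"
    using assms(1) laplacian_row_sum[OF \<open>i < N\<close>, of E "\<lambda>e. of_bool (e \<in> F)" x] by (simp add: K_def)
  also have "\<dots> = x i - x k0 + (\<Sum>k\<in>K - {k0}. of_bool ({i, k} \<in> F) * (x i - x k))"
    unfolding sum.remove[OF K] using \<open>{i, k0} \<in> F\<close> by simp
  also have "(\<Sum>k\<in>K - {k0}. of_bool ({i, k} \<in> F) * (x i - x k)) = 0"
    by (rule sum.neutral) (auto simp: K_def others)
  finally show ?thesis by simp
qed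

text \<open>
  The weights are the indicator of a spanning forest \<open>F\<close> with parent function \<open>q\<close> and roots \<open>W\<close>, the
  complement of \<open>J\<close>: on the paths \<open>q\<close> is the inverse of \<open>\<sigma>\<close>, elsewhere a step towards the paths. The
  equations indexed by \<open>I\<close> are then triangular with respect to the parent edges. The edge above a
  vertex \<open>v\<close> off the paths is settled by the equation at \<open>v\<close>, children first; the edge
  from \<open>\<sigma> u\<close> up to a path vertex \<open>u\<close> by the equation at \<open>u\<close>, parents first. Every vertex off the paths
  lies in \<open>I\<close>, so the equations used are available.
\<close>
lemma laplacian_minor_trivial_kernel:
  assumes conn: "connected_graph N E"
    and sub: "I \<subseteq> {..<N}" "J \<subseteq> {..<N}" and proper: "card I < N"
    and bij: "bij_betw \<sigma> I J"
    and edge: "\<And>i. i \<in> I \<Longrightarrow> \<sigma> i = i \<or> {i, \<sigma> i} \<in> E"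
  obtains w :: "nat set \<Rightarrow> real"
  where "\<And>x v. (\<And>v. v < N \<Longrightarrow> v \<notin> J \<Longrightarrow> x v = 0) \<Longrightarrow>
    (\<And>i. i \<in> I \<Longrightarrow> (\<Sum>j<N. laplacian N E w $$ (i, j) * x j) = 0) \<Longrightarrow> v < N \<Longrightarrow> x v = 0"
proof -
  define W where "W = {..<N} - J"
  define Z where "Z = path_vertices \<sigma> I W"
  have im: "\<sigma> ` I = J" and inj: "inj_on \<sigma> I"
    using bij by (auto simp: bij_betw_def)
  have "card J < N" using bij_betw_same_card[OF bij] proper by simp
  then have "W \<noteq> {}" unfolding W_def using sub
    by (metis Diff_eq_empty_iff card_lessThan order_less_irrefl subset_antisym)
  have WZ: "W \<subseteq> Z" by (auto simp: Z_def intro: path_vertices.start)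
  then have Zne: "Z \<noteq> {}" using \<open>W \<noteq> {}\<close> by blast
  have ZV: "Z \<subseteq> {..<N}" unfolding Z_def
    by (rule path_vertices_subset) (use im sub in \<open>auto simp: W_def\<close>)
  have offZ: "v \<in> I" if "v < N" "v \<notin> Z" for v
    using unmatched_on_paths[OF _ sub bij] that unfolding Z_def W_def by auto
  obtain p and d :: "nat \<Rightarrow> nat"
    where p: "\<And>v. v < N \<Longrightarrow> v \<notin> Z \<Longrightarrow> {v, p v} \<in> E \<and> d (p v) < d v"
    using parents_towards_set[OF conn ZV Zne] by blast
  define q where "q v = (if v \<in> Z then inv_into I \<sigma> v else p v)" for v
  define F where "F = {{v, q v} | v. v < N \<and> v \<notin> W}"
  have q_step: "q (\<sigma> u) = u" if "u \<in> Z" "u \<in> I" for u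
    using that inj by (auto simp: q_def Z_def intro: path_vertices.step)
  have F_cases: "(k = q i \<and> i \<notin> W) \<or> (i = q k \<and> k \<notin> W)" if "{i, k} \<in> F" for i k
    using that by (auto simp: F_def doubleton_eq_iff)
  have q_Z: "q k \<in> Z \<and> \<sigma> (q k) = k \<and> q k \<in> I" if k: "k \<in> Z" "k \<notin> W" for k
  proof -
    have "k \<in> path_vertices \<sigma> I W" using k by (simp add: Z_def)
    then obtain u where "k = \<sigma> u" "u \<in> Z" "u \<in> I"
      by cases (use k in \<open>auto simp: Z_def\<close>)
    then show ?thesis using q_step by auto
  qed
  show thesis
  proof (rule that)
    fix x :: "nat \<Rightarrow> real" and v
    assume zero: "\<And>v. v < N \<Longrightarrow> v \<notin> J \<Longrightarrow> x v = 0"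
      and harm: "\<And>i. i \<in> I \<Longrightarrow>
        (\<Sum>j<N. laplacian N E (\<lambda>e. of_bool (e \<in> F)) $$ (i, j) * x j) = 0"
      and vN: "v < N"
    \<comment> \<open>Off the paths: induction on decreasing distance, that is, from the leaves.\<close>
    have flat: "x v = x (p v)" if "v < N" "v \<notin> Z" for v
      using that
    proof (induction "Max (d ` {..<N}) - d v" arbitrary: v rule: less_induct)
      case less
      have pv: "{v, p v} \<in> E" "d (p v) < d v" using p less.prems by auto
      have "x (p v) = x v"
      proof (rule harmonic_single_neighbour[OF harm])
        show "v \<in> I" using offZ less.prems by blast
        show "v < N" by fact
        show "p v < N" "p v \<noteq> v" "{v, p v} \<in> E"
          using connected_graph_vertices[OF conn pv(1)] pv by auto
        show "{v, p v} \<in> F"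
          using less.prems WZ unfolding F_def q_def by force
        fix k assume k: "k < N" "k \<noteq> v" "k \<noteq> p v" "{v, k} \<in> F"
        then have "v = q k" "k \<notin> W"
          using F_cases[of v k] less.prems by (auto simp: q_def)
        then have kZ: "k \<notin> Z" using q_Z less.prems by blast
        then have vk: "v = p k" using \<open>v = q k\<close> by (simp add: q_def)
        then have "d v < d k" using p[of k] k kZ by auto
        moreover have "d k \<le> Max (d ` {..<N})" using k by (intro Max_ge) auto
        ultimately have "Max (d ` {..<N}) - d k < Max (d ` {..<N}) - d v"
          by linarith
        then have "x k = x (p k)"
          using less.hyps k kZ by blast
        then show "x k = x v" using vk by simp
      qed
      then show ?case by simp
    qed
    \<comment> \<open>On the paths: the value at the parent is carried along, since the equation at \<open>u\<close> yields
      the value at \<open>\<sigma> u\<close> only once the neighbour before \<open>u\<close> is known to agree with \<open>u\<close>.\<close>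
    have onZ: "x z = 0 \<and> (z \<notin> W \<longrightarrow> x (q z) = 0)" if "z \<in> path_vertices \<sigma> I W" for z
      using that
    proof induction
      case (start w)
      then show ?case using zero by (auto simp: W_def)
    next
      case (step u)
      have u: "u \<in> Z" "u < N" using step ZV by (auto simp: Z_def)
      have su: "\<sigma> u \<in> Z" "\<sigma> u \<notin> W" "\<sigma> u < N" using step im sub
        by (auto simp: Z_def W_def intro: path_vertices.step)
      have "x (\<sigma> u) = x u"
      proof (cases "\<sigma> u = u")
        case False
        then have e: "{u, \<sigma> u} \<in> E" using edge step by blast
        show ?thesis
        proof (rule harmonic_single_neighbour[OF harm])
          show "u \<in> I" "u < N" "\<sigma> u < N" "\<sigma> u \<noteq> u" "{u, \<sigma> u} \<in> E"
            using u e su False step by auto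
          have "{u, \<sigma> u} = {\<sigma> u, q (\<sigma> u)}" using q_step u step by auto
          then show "{u, \<sigma> u} \<in> F" unfolding F_def using su by blast
          fix k assume k: "k < N" "k \<noteq> u" "k \<noteq> \<sigma> u" "{u, k} \<in> F"
          then consider "k = q u" "u \<notin> W" | "u = q k" "k \<notin> W"
            using F_cases by blast
          then show "x k = x u"
          proof cases
            case 1
            then show ?thesis using step.IH by auto
          next
            case 2
            then have "k \<notin> Z" using q_Z[of k] k by auto
            then show ?thesis using flat[of k] k 2 by (simp add: q_def)
          qed
        qed
      qed simp
      then show ?case using step.IH q_step u step.hyps by auto
    qed
    show "x v = 0"
      using vN
    proof (induction "d v" arbitrary: v rule: less_induct)
      case less
      show ?case
      proof (cases "v \<in> Z")
        case True
        then show ?thesis using onZ by (auto simp: Z_def)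
      next
        case False
        then show ?thesis
          using p[OF less.prems False] flat[OF less.prems False] less.hyps[of "p v"]
            connected_graph_vertices[OF conn] by auto
      qed
    qed
  qed
qed

section \<open>Zeros of polynomials in independent continuous variables\<close>

text \<open>
  This captures what an induction over the variables with Fubini's theorem asks of a polynomial
  function: measurability, and in each variable separately only finitely many zeros unless it
  vanishes identically. The points range over \<open>extensional F\<close>, the space of the product measure over \<open>F\<close>.
\<close>
definition coordinatewise_polynomial :: "'i set \<Rightarrow> (('i \<Rightarrow> real) \<Rightarrow> real) \<Rightarrow> bool" where
  "coordinatewise_polynomial F f \<longleftrightarrow>
     f \<in> borel_measurable (PiM F (\<lambda>_. borel)) \<and>
     (\<forall>x\<in>extensional F. \<forall>e\<in>F. \<exists>p. \<forall>t. f (x(e := t)) = poly p t)"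

lemma coordinatewise_polynomial_const: "coordinatewise_polynomial F (\<lambda>_. c)"
proof -
  have "\<exists>p. \<forall>t::real. c = poly p t" by (rule exI[of _ "[:c:]"]) simp
  then show ?thesis by (simp add: coordinatewise_polynomial_def)
qed

lemma coordinatewise_polynomial_component:
  assumes "e \<in> F" shows "coordinatewise_polynomial F (\<lambda>x. x e)"
proof -
  have "\<exists>p. \<forall>t. (x(e' := t)) e = poly p t" for x :: "'a \<Rightarrow> real" and e'
    by (rule exI[of _ "if e' = e then [:0, 1:] else [:x e:]"]) simp
  then show ?thesis
    using assms by (auto simp: coordinatewise_polynomial_def)
qed

lemma coordinatewise_polynomial_add:
  assumes "coordinatewise_polynomial F f" "coordinatewise_polynomial F g"
  shows "coordinatewise_polynomial F (\<lambda>x. f x + g x)"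
  unfolding coordinatewise_polynomial_def
proof (intro conjI ballI)
  show "(\<lambda>x. f x + g x) \<in> borel_measurable (PiM F (\<lambda>_. borel))"
    using assms by (intro borel_measurable_add) (simp_all add: coordinatewise_polynomial_def)
  fix x :: "'a \<Rightarrow> real" and e assume "x \<in> extensional F" "e \<in> F"
  then obtain p q where "\<And>t. f (x(e := t)) = poly p t" "\<And>t. g (x(e := t)) = poly q t"
    using assms unfolding coordinatewise_polynomial_def by blast
  then have "\<forall>t. f (x(e := t)) + g (x(e := t)) = poly (p + q) t" by simp
  then show "\<exists>p. \<forall>t. f (x(e := t)) + g (x(e := t)) = poly p t" by (rule exI)
qed

lemma coordinatewise_polynomial_mult:
  assumes "coordinatewise_polynomial F f" "coordinatewise_polynomial F g"
  shows "coordinatewise_polynomial F (\<lambda>x. f x * g x)"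
  unfolding coordinatewise_polynomial_def
proof (intro conjI ballI)
  show "(\<lambda>x. f x * g x) \<in> borel_measurable (PiM F (\<lambda>_. borel))"
    using assms by (intro borel_measurable_times) (simp_all add: coordinatewise_polynomial_def)
  fix x :: "'a \<Rightarrow> real" and e assume "x \<in> extensional F" "e \<in> F"
  then obtain p q where "\<And>t. f (x(e := t)) = poly p t" "\<And>t. g (x(e := t)) = poly q t"
    using assms unfolding coordinatewise_polynomial_def by blast
  then have "\<forall>t. f (x(e := t)) * g (x(e := t)) = poly (p * q) t" by simp
  then show "\<exists>p. \<forall>t. f (x(e := t)) * g (x(e := t)) = poly p t" by (rule exI)
qed

lemma coordinatewise_polynomial_sum:
  assumes "\<And>a. a \<in> A \<Longrightarrow> coordinatewise_polynomial F (f a)"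
  shows "coordinatewise_polynomial F (\<lambda>x. \<Sum>a\<in>A. f a x)"
  using assms
  by (induction A rule: infinite_finite_induct)
     (simp_all add: coordinatewise_polynomial_const coordinatewise_polynomial_add)

lemma coordinatewise_polynomial_prod:
  assumes "\<And>a. a \<in> A \<Longrightarrow> coordinatewise_polynomial F (f a)"
  shows "coordinatewise_polynomial F (\<lambda>x. \<Prod>a\<in>A. f a x)"
  using assms
  by (induction A rule: infinite_finite_induct)
     (simp_all add: coordinatewise_polynomial_const coordinatewise_polynomial_mult)

lemma coordinatewise_polynomial_laplacian:
  assumes "i < N" "j < N"
  shows "coordinatewise_polynomial E (\<lambda>x. laplacian N E x $$ (i, j))"
proof (cases "i = j")
  case True
  then show ?thesis using assms
    by (auto simp: laplacian_def intro!: coordinatewise_polynomial_sum coordinatewise_polynomial_component)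
next
  case False
  have "coordinatewise_polynomial E (\<lambda>x. (-1) * x {i, j})" if "{i, j} \<in> E"
    by (intro coordinatewise_polynomial_mult coordinatewise_polynomial_const
        coordinatewise_polynomial_component that)
  then show ?thesis using assms False
    by (cases "{i, j} \<in> E") (simp_all add: laplacian_def coordinatewise_polynomial_const)
qed

text \<open>The Leibniz formula writes the determinant as sums and products of its entries.\<close>
lemma coordinatewise_polynomial_det:
  assumes "\<And>a b. a < m \<Longrightarrow> b < m \<Longrightarrow> coordinatewise_polynomial F (\<lambda>x. A x a b)"
  shows "coordinatewise_polynomial F (\<lambda>x. det (mat m m (\<lambda>(a, b). A x a b)))"
proof -
  have eq: "det (mat m m (\<lambda>(a, b). A x a b)) =
      (\<Sum>\<pi> | \<pi> permutes {0..<m}. signof \<pi> * (\<Prod>a = 0..<m. A x a (\<pi> a)))" for x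
    unfolding det_def by (auto intro!: sum.cong prod.cong dest: permutes_in_image)
  show ?thesis unfolding eq
    by (intro coordinatewise_polynomial_sum coordinatewise_polynomial_mult
        coordinatewise_polynomial_const coordinatewise_polynomial_prod assms)
       (auto dest: permutes_in_image)
qed

text \<open>
  Induction over the variables. Freezing the new variable \<open>i\<close> at its value in the known nonzero point
  \<open>x0\<close> leaves a function \<open>g\<close> of the others that is almost surely nonzero. Where \<open>g\<close> is nonzero, \<open>f\<close>
  is a nonzero polynomial in the variable \<open>i\<close>; its finitely many roots have measure zero in the absence
  of atoms, and Fubini's theorem combines the two.
\<close>
lemma AE_coordinatewise_polynomial_nonzero:
  fixes \<mu> :: "'i \<Rightarrow> real measure"
  assumes fin: "finite F"
    and prob: "\<And>i. prob_space (\<mu> i)" and sets: "\<And>i. sets (\<mu> i) = sets borel"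
    and atomless: "\<And>i t. i \<in> F \<Longrightarrow> emeasure (\<mu> i) {t} = 0"
    and "coordinatewise_polynomial F f" and "x0 \<in> extensional F" "f x0 \<noteq> 0"
  shows "AE x in PiM F \<mu>. f x \<noteq> 0"
proof -
  interpret product_prob_space \<mu> UNIV
    by (intro product_prob_spaceI prob)
  have sets_PiM: "sets (PiM G \<mu>) = sets (PiM G (\<lambda>_. borel))" for G
    by (rule sets_PiM_cong) (auto simp: sets)
  have space_mu: "space (\<mu> i) = UNIV" for i
    using sets_eq_imp_space_eq[OF sets[of i]] by simp
  have space_PiM': "space (PiM G \<mu>) = extensional G" for G
    by (auto simp: space_PiM space_mu PiE_def)
  show ?thesis using fin atomless assms(5-)
  proof (induction F arbitrary: f x0)
    case empty
    then show ?case
      by (intro AE_I2) (auto simp: space_PiM')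
  next
    case (insert i F)
    have meas: "f \<in> borel_measurable (PiM (insert i F) \<mu>)"
      using insert.prems(2) measurable_cong_sets[OF sets_PiM refl]
      by (auto simp: coordinatewise_polynomial_def)
    have poly: "\<exists>p. \<forall>t. f (x(e := t)) = poly p t" if "x \<in> extensional (insert i F)" "e \<in> insert i F" for x e
      using insert.prems(2) that by (auto simp: coordinatewise_polynomial_def)
    define g where "g x = f (x(i := x0 i))" for x
    have ext: "x(i := t) \<in> extensional (insert i F)" if "x \<in> extensional F" for x :: "'i \<Rightarrow> real" and t
      using that by (auto simp: extensional_def)
    have "AE x in PiM F \<mu>. g x \<noteq> 0"
    proof (rule insert.IH)
      show "coordinatewise_polynomial F g"
        unfolding coordinatewise_polynomial_def
      proof (intro conjI ballI)
        have "f \<in> borel_measurable (PiM (insert i F) (\<lambda>_. borel))"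
          using insert.prems(2) by (simp add: coordinatewise_polynomial_def)
        moreover have "(\<lambda>x. x(i := x0 i)) \<in> measurable (PiM F (\<lambda>_. borel)) (PiM (insert i F) (\<lambda>_. borel))"
          by (rule measurable_fun_upd[of _ F]) auto
        ultimately show "g \<in> borel_measurable (PiM F (\<lambda>_. borel))"
          unfolding g_def by (rule measurable_compose[rotated])
        fix x :: "'i \<Rightarrow> real" and e assume x: "x \<in> extensional F" and e: "e \<in> F"
        have "\<exists>p. \<forall>t. f ((x(i := x0 i))(e := t)) = poly p t"
          using poly[OF ext[OF x]] e by auto
        moreover have "i \<noteq> e" using e insert.hyps by auto
        ultimately show "\<exists>p. \<forall>t. g (x(e := t)) = poly p t"
          by (simp add: g_def fun_upd_twist)
      qed
      show "restrict x0 F \<in> extensional F" by simp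
      have "(restrict x0 F)(i := x0 i) = x0"
        using insert.prems(3) by (auto simp: extensional_def fun_eq_iff)
      then show "g (restrict x0 F) \<noteq> 0"
        using insert.prems(4) by (simp add: g_def)
    qed (use insert.prems in auto)
    moreover have "AE t in \<mu> i. f (x(i := t)) \<noteq> 0"
      if x: "x \<in> space (PiM F \<mu>)" and gx: "g x \<noteq> 0" for x
    proof -
      have x': "x \<in> extensional F" using x by (simp add: space_PiM')
      obtain p where p: "\<And>t. f ((x(i := 0))(i := t)) = poly p t"
        using poly[OF ext[OF x'], of i] by blast
      then have p': "f (x(i := t)) = poly p t" for t by simp
      have "p \<noteq> 0" using gx p'[of "x0 i"] by (auto simp: g_def)
      then have fr: "finite {t. poly p t = 0}" by (rule poly_roots_finite)
      have "AE t in \<mu> i. \<forall>r\<in>{t. poly p t = 0}. t \<noteq> r"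
      proof (rule AE_finite_allI[OF fr])
        fix r
        have "{r} \<in> null_sets (\<mu> i)"
          using insert.prems(1)[of i r] by (auto simp: null_sets_def sets)
        from AE_not_in[OF this] show "AE t in \<mu> i. t \<noteq> r" by simp
      qed
      then show ?thesis by eventually_elim (auto simp: p')
    qed
    ultimately have AE2: "AE x in PiM F \<mu>. AE t in \<mu> i. f (x(i := t)) \<noteq> 0"
      by (auto elim: AE_mp)
    define h :: "('i \<Rightarrow> real) \<Rightarrow> ennreal" where "h x = indicator {x. f x = 0} x" for x
    have hm: "h \<in> borel_measurable (PiM (insert i F) \<mu>)"
      unfolding h_def using meas by measurable
    have "integral\<^sup>N (PiM (insert i F) \<mu>) h =
        (\<integral>\<^sup>+ x. (\<integral>\<^sup>+ t. h (x(i := t)) \<partial>\<mu> i) \<partial>PiM F \<mu>)"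
      by (rule product_nn_integral_insert[OF insert.hyps hm])
    also have "\<dots> = (\<integral>\<^sup>+ x. 0 \<partial>PiM F \<mu>)"
    proof (rule nn_integral_cong_AE)
      show "AE x in PiM F \<mu>. (\<integral>\<^sup>+ t. h (x(i := t)) \<partial>\<mu> i) = 0"
        using AE2
      proof eventually_elim
        case (elim x)
        then have "(\<integral>\<^sup>+ t. h (x(i := t)) \<partial>\<mu> i) = (\<integral>\<^sup>+ t. 0 \<partial>\<mu> i)"
          by (intro nn_integral_cong_AE) (auto simp: h_def)
        then show ?case by simp
      qed
    qed
    finally have "integral\<^sup>N (PiM (insert i F) \<mu>) h = 0" by simp
    then have "AE x in PiM (insert i F) \<mu>. h x = 0"
      using hm by (simp add: nn_integral_0_iff_AE)
    then show ?case by eventually_elim (auto simp: h_def indicator_def)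
  qed
qed

lemma (in prob_space) AE_indep_polynomial_nonzero:
  fixes X :: "'i \<Rightarrow> 'a \<Rightarrow> real"
  assumes fin: "finite F" and indep: "indep_vars (\<lambda>_. borel) X F"
    and cont: "\<And>i. i \<in> F \<Longrightarrow> continuous_rv M (X i)"
    and poly: "coordinatewise_polynomial F f"
    and x0: "x0 \<in> extensional F" "f x0 \<noteq> 0"
  shows "AE \<omega> in M. f (\<lambda>i\<in>F. X i \<omega>) \<noteq> 0"
proof (cases "F = {}")
  case True
  then show ?thesis using x0 by (intro AE_I2) (simp add: restrict_def)
next
  case False
  \<comment> \<open>The product is formed from a family of probability measures over all indices, so those
    outside \<open>F\<close> get an arbitrary one.\<close>
  define \<mu> where "\<mu> i = (if i \<in> F then distr M borel (X i) else return borel 0)" for i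
  have rv: "X i \<in> borel_measurable M" if "i \<in> F" for i
    using cont[OF that] by (simp add: continuous_rv_def)
  have meas: "(\<lambda>\<omega>. \<lambda>i\<in>F. X i \<omega>) \<in> measurable M (PiM F (\<lambda>_. borel))"
    by (rule measurable_restrict) (rule rv)
  have "AE x in PiM F \<mu>. f x \<noteq> 0"
  proof (rule AE_coordinatewise_polynomial_nonzero[OF fin _ _ _ poly x0])
    show "prob_space (\<mu> i)" for i
      by (auto simp: \<mu>_def intro!: prob_space_distr prob_space_return rv)
    show "sets (\<mu> i) = sets borel" for i by (simp add: \<mu>_def)
    fix i t assume i: "i \<in> F"
    interpret D: real_distribution "distr M borel (X i)"
      using rv[OF i] by (rule real_distribution_distr)
    have "isCont (cdf (distr M borel (X i))) t"
      using cont[OF i] by (simp add: continuous_rv_def continuous_on_eq_continuous_at)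
    then show "emeasure (\<mu> i) {t} = 0"
      using i by (simp add: \<mu>_def D.isCont_cdf D.emeasure_eq_measure)
  qed
  also have "PiM F \<mu> = PiM F (\<lambda>i. distr M borel (X i))"
    by (rule PiM_cong) (simp_all add: \<mu>_def)
  also have "\<dots> = distr M (PiM F (\<lambda>_. borel)) (\<lambda>\<omega>. \<lambda>i\<in>F. X i \<omega>)"
    using indep_vars_iff_distr_eq_PiM'[of F X "\<lambda>_. borel"] False rv indep by simp
  finally show ?thesis
    by (rule AE_distrD[OF meas])
qed

section \<open>The generic rank of a submatrix of the Laplacian\<close>

text \<open>
  The trivial kernel in terms of determinants: a kernel vector of the minor, extended by \<open>0\<close> outside the
  columns \<open>J\<close>, solves the equations of \<open>laplacian_minor_trivial_kernel\<close>.
\<close>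
lemma laplacian_minor_nonzero:
  assumes conn: "connected_graph N E"
    and sub: "I \<subseteq> {..<N}" "J \<subseteq> {..<N}" and proper: "m < N"
    and \<alpha>: "bij_betw \<alpha> {..<m} I" and \<beta>: "bij_betw \<beta> {..<m} J" and bij: "bij_betw \<sigma> I J"
    and edge: "\<And>i. i \<in> I \<Longrightarrow> \<sigma> i = i \<or> {i, \<sigma> i} \<in> E"
  obtains w where "det (mat m m (\<lambda>(a, b). laplacian N E w $$ (\<alpha> a, \<beta> b))) \<noteq> 0"
proof -
  have "card I < N" using bij_betw_same_card[OF \<alpha>] proper by simp
  then obtain w where w: "\<And>x v. (\<And>v. v < N \<Longrightarrow> v \<notin> J \<Longrightarrow> x v = 0) \<Longrightarrow>
    (\<And>i. i \<in> I \<Longrightarrow> (\<Sum>j<N. laplacian N E w $$ (i, j) * x j) = 0) \<Longrightarrow> v < N \<Longrightarrow> x v = 0"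
    using laplacian_minor_trivial_kernel[OF conn sub _ bij edge] by blast
  define C where "C = mat m m (\<lambda>(a, b). laplacian N E w $$ (\<alpha> a, \<beta> b))"
  have C: "C \<in> carrier_mat m m" by (simp add: C_def)
  have "det C \<noteq> 0"
  proof
    assume "det C = 0"
    then obtain v where v: "v \<in> carrier_vec m" "v \<noteq> 0\<^sub>v m" "C *\<^sub>v v = 0\<^sub>v m"
      using det_0_iff_vec_prod_zero[OF C] by blast
    define x where "x j = (if j \<in> J then v $ inv_into {..<m} \<beta> j else 0)" for j
    have x\<beta>: "x (\<beta> b) = v $ b" if "b < m" for b
      using \<beta> that by (auto simp: x_def bij_betw_def)
    have "x j = 0" if "j < N" for j
    proof (rule w[OF _ _ that])
      show "x u = 0" if "u \<notin> J" for u using that by (simp add: x_def)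
      fix i assume "i \<in> I"
      then obtain a where a: "a < m" "i = \<alpha> a" using \<alpha> by (auto simp: bij_betw_def)
      have "(\<Sum>j<N. laplacian N E w $$ (i, j) * x j) = (\<Sum>j\<in>J. laplacian N E w $$ (i, j) * x j)"
        by (rule sum.mono_neutral_right) (use sub in \<open>auto simp: x_def\<close>)
      also have "\<dots> = (\<Sum>b<m. laplacian N E w $$ (i, \<beta> b) * x (\<beta> b))"
        by (rule sum.reindex_bij_betw[OF \<beta>, symmetric])
      also have "\<dots> = (C *\<^sub>v v) $ a"
        using a v(1) by (auto simp: C_def scalar_prod_def x\<beta> lessThan_atLeast0 intro!: sum.cong)
      also have "\<dots> = 0" using v(3) a by simp
      finally show "(\<Sum>j<N. laplacian N E w $$ (i, j) * x j) = 0" .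
    qed
    then have "v $ b = 0" if "b < m" for b
      using x\<beta>[OF that] sub \<beta> that by (auto simp: bij_betw_def)
    then have "v = 0\<^sub>v m" using v(1) by (intro eq_vecI) auto
    then show False using v(2) by simp
  qed
  then show thesis unfolding C_def by (rule that)
qed

lemma laplacian_nonzero_entry:
  assumes "laplacian N E w $$ (i, j) \<noteq> 0" "i < N" "j < N"
  shows "j = i \<or> {i, j} \<in> E"
  using assms by (auto simp: laplacian_def split: if_splits)

lemma laplacian_restrict: "laplacian N E (restrict w E) = laplacian N E w"
  unfolding laplacian_def by (intro cong_mat) auto

lemma structural_rank_attained:
  obtains S where "independent_entries A S" "card S = structural_rank A"
proof -
  have "{card S | S. independent_entries A S} \<subseteq>
      card ` Pow ({0..<dim_row A} \<times> {0..<dim_col A})"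
    by (auto simp: independent_entries_def)
  then have "finite {card S | S. independent_entries A S}"
    by (rule finite_subset) simp
  moreover have "independent_entries A {}" by (simp add: independent_entries_def)
  ultimately have "structural_rank A \<in> {card S | S. independent_entries A S}"
    unfolding structural_rank_def by (intro Max_in) auto
  then show thesis using that by auto
qed

lemma bij_betw_pick:
  assumes "finite S" shows "bij_betw (pick S) {..<card S} S"
proof -
  have "inj_on (pick S) {..<card S}"
    by (rule linorder_inj_onI') (use pick_mono_le in \<open>fastforce\<close>)
  moreover have "pick S ` {..<card S} \<subseteq> S" using pick_in_set_le by blast
  ultimately show ?thesis
    using assms by (simp add: bij_betw_def card_image card_subset_eq)
qed

lemma mat_rank_le_dim_row: "mat_rank (A :: 'a::field mat) \<le> dim_row A"
proof -
  interpret vec_space "TYPE('a)" "dim_row A" .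
  have A: "A \<in> carrier_mat (dim_row A) (dim_col A)" by simp
  have "set (cols A) \<subseteq> carrier_vec (dim_row A)" by (rule cols_dim)
  then have "subspace class_ring (span (set (cols A))) V"
    by (simp add: span_is_subspace)
  then have "vectorspace.dim class_ring (span_vs (set (cols A))) \<le> dim"
    using fin_dim_span_cols[OF A] by (intro subspace_dim) auto
  then show ?thesis by (simp add: rank_def dim_is_n)
qed

theorem theorem1:
  fixes M :: "'a measure"
    and N N' N'' :: nat
    and E :: "nat set set"
    and w :: "nat set \<Rightarrow> 'a \<Rightarrow> real"
    and I J :: "nat set"
  defines "B \<equiv> \<lambda>\<omega>. laplacian N E (\<lambda>e. w e \<omega>)"
  assumes "prob_space M"
    and "connected_graph N E"
    and "prob_space.indep_vars M (\<lambda>_. borel) w E"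
    and "\<And>e. e \<in> E \<Longrightarrow> continuous_rv M (w e)"
    and "\<And>e. e \<in> E \<Longrightarrow> bounded_away_from_zero M (w e)"
    and "I \<subseteq> {0..<N}" and "card I = N'"
    and "J \<subseteq> {0..<N}" and "card J = N''"
    and "min N' N'' \<le> N - 1"
    and "AE \<omega> in M. structural_rank (submatrix (B \<omega>) I J) = min N' N''"
  shows "AE \<omega> in M. mat_rank (submatrix (B \<omega>) I J) = min N' N''"
proof -
  interpret prob_space M by fact
  note conn = \<open>connected_graph N E\<close>
  define m where "m = min N' N''"
  have "0 < N" using conn by (simp add: connected_graph_def)
  then have mN: "m < N" using \<open>min N' N'' \<le> N - 1\<close> by (simp add: m_def)
  have finIJ: "finite I" "finite J"
    using \<open>I \<subseteq> {0..<N}\<close> \<open>J \<subseteq> {0..<N}\<close> finite_subset by blast+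
  have "E \<subseteq> Pow {..<N}"
    using conn by (auto simp: connected_graph_def simple_graph_def)
  then have finE: "finite E" by (rule finite_subset) simp
  define H where "H \<omega> = submatrix (B \<omega>) I J" for \<omega>
  have "{i. i < N \<and> i \<in> I} = I" "{j. j < N \<and> j \<in> J} = J"
    using \<open>I \<subseteq> {0..<N}\<close> \<open>J \<subseteq> {0..<N}\<close> by auto
  then have H: "H \<omega> = mat N' N'' (\<lambda>(a, b). B \<omega> $$ (pick I a, pick J b))" for \<omega>
    using \<open>card I = N'\<close> \<open>card J = N''\<close> by (simp add: H_def submatrix_def B_def laplacian_def)
  have pickI: "bij_betw (pick I) {..<N'} I" and pickJ: "bij_betw (pick J) {..<N''} J"
    using bij_betw_pick finIJ \<open>card I = N'\<close> \<open>card J = N''\<close> by auto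

  \<comment> \<open>One outcome with full structural rank provides the rows \<open>P\<close>, the columns \<open>Q\<close> and the matching
    for almost all outcomes; both index sets count positions inside the submatrix.\<close>
  have "\<exists>\<omega>. structural_rank (H \<omega>) = m"
    using assms(12) unfolding H_def m_def by (rule eventually_happens'[OF ae_filter_bot])
  then obtain \<omega>0 where "structural_rank (H \<omega>0) = m" by blast
  then obtain S where S: "independent_entries (H \<omega>0) S" "card S = m"
    using structural_rank_attained[of "H \<omega>0"] by metis
  have Ssub: "S \<subseteq> {..<N'} \<times> {..<N''}"
    using S(1) by (auto simp: independent_entries_def H)
  have inj: "inj_on fst S" "inj_on snd S"
    using S(1) unfolding independent_entries_def inj_on_def by metis+
  define P where "P = fst ` S"
  define Q where "Q = snd ` S"
  have finS: "finite S" using Ssub by (rule finite_subset) simp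
  then have PQ: "finite P" "finite Q" "card P = m" "card Q = m" "P \<subseteq> {..<N'}" "Q \<subseteq> {..<N''}"
    using S(2) inj Ssub by (auto simp: P_def Q_def card_image)
  have pickP: "pick P a < N'" and pickQ: "pick Q a < N''" if "a < m" for a
    using that PQ pick_in_set_le[of a P] pick_in_set_le[of a Q] by auto
  define \<alpha> where "\<alpha> = pick I \<circ> pick P"
  define \<beta> where "\<beta> = pick J \<circ> pick Q"
  have \<alpha>: "bij_betw \<alpha> {..<m} (pick I ` P)"
    unfolding \<alpha>_def using bij_betw_pick[OF PQ(1)] bij_betw_subset[OF pickI PQ(5) refl] PQ
    by (metis bij_betw_trans)
  have \<beta>: "bij_betw \<beta> {..<m} (pick J ` Q)"
    unfolding \<beta>_def using bij_betw_pick[OF PQ(2)] bij_betw_subset[OF pickJ PQ(6) refl] PQ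
    by (metis bij_betw_trans)
  have rows: "bij_betw (pick I \<circ> fst) S (pick I ` P)"
    using bij_betw_subset[OF pickI PQ(5) refl] inj(1)
    by (intro bij_betw_trans) (auto simp: bij_betw_def P_def)
  have cols: "bij_betw (pick J \<circ> snd) S (pick J ` Q)"
    using bij_betw_subset[OF pickJ PQ(6) refl] inj(2)
    by (intro bij_betw_trans) (auto simp: bij_betw_def Q_def)
  have sub: "pick I ` P \<subseteq> {..<N}" "pick J ` Q \<subseteq> {..<N}"
    using pickI pickJ PQ(5,6) \<open>I \<subseteq> {0..<N}\<close> \<open>J \<subseteq> {0..<N}\<close>
    by (fastforce simp: bij_betw_def)+
  define f where "f x = det (mat m m (\<lambda>(a, b). laplacian N E x $$ (\<alpha> a, \<beta> b)))" for x
  obtain w0 where w0: "f w0 \<noteq> 0"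
  proof (rule laplacian_minor_nonzero[OF conn sub mN \<alpha> \<beta>])
    show "bij_betw ((pick J \<circ> snd) \<circ> inv_into S (pick I \<circ> fst)) (pick I ` P) (pick J ` Q)"
      using bij_betw_trans[OF bij_betw_inv_into[OF rows] cols] .
    fix i assume "i \<in> pick I ` P"
    then obtain s where s: "s \<in> S" "i = pick I (fst s)" by (auto simp: P_def)
    then have inv: "inv_into S (pick I \<circ> fst) i = s"
      using bij_betw_inv_into_left[OF rows] by fastforce
    have "H \<omega>0 $$ s \<noteq> 0" using S(1) s(1) by (auto simp: independent_entries_def)
    then have "B \<omega>0 $$ (i, pick J (snd s)) \<noteq> 0"
      using s Ssub by (cases s) (auto simp: H)
    moreover have "i < N" "pick J (snd s) < N"
      using sub s by (auto simp: P_def Q_def)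
    ultimately show "((pick J \<circ> snd) \<circ> inv_into S (pick I \<circ> fst)) i = i \<or>
        {i, ((pick J \<circ> snd) \<circ> inv_into S (pick I \<circ> fst)) i} \<in> E"
      unfolding B_def using laplacian_nonzero_entry inv by simp
  qed (auto simp: f_def)
  have "\<alpha> a < N" "\<beta> a < N" if "a < m" for a
    using bij_betwE[OF \<alpha>] bij_betwE[OF \<beta>] sub that by blast+
  then have poly: "coordinatewise_polynomial E f" unfolding f_def
    by (intro coordinatewise_polynomial_det coordinatewise_polynomial_laplacian)
  have "AE \<omega> in M. f (\<lambda>e\<in>E. w e \<omega>) \<noteq> 0"
  proof (rule AE_indep_polynomial_nonzero[OF finE assms(4) _ poly])
    show "f (restrict w0 E) \<noteq> 0" using w0 by (simp add: f_def laplacian_restrict)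
  qed (simp_all add: assms(5))
  then have "AE \<omega> in M. f (\<lambda>e. w e \<omega>) \<noteq> 0"
    by (simp add: f_def laplacian_restrict)
  then show ?thesis
  proof eventually_elim
    case (elim \<omega>)
    have dims: "dim_row (H \<omega>) = N'" "dim_col (H \<omega>) = N''" by (simp_all add: H)
    have Hc: "H \<omega> \<in> carrier_mat N' N''" by (simp add: H)
    have setPQ: "{i. i < N' \<and> i \<in> P} = P" "{j. j < N'' \<and> j \<in> Q} = Q" using PQ by auto
    have "submatrix (H \<omega>) P Q = mat m m (\<lambda>(a, b). laplacian N E (\<lambda>e. w e \<omega>) $$ (\<alpha> a, \<beta> b))"
      unfolding submatrix_def dims setPQ PQ(3,4)
      by (intro eq_matI) (simp_all add: H B_def \<alpha>_def \<beta>_def pickP pickQ)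
    then have "det (submatrix (H \<omega>) P Q) \<noteq> 0" using elim by (simp add: f_def)
    from vec_space.rank_gt_minor[OF Hc this] have "m \<le> vec_space.rank N' (H \<omega>)"
      using setPQ PQ by simp
    moreover have "vec_space.rank N' (H \<omega>) \<le> N'"
      using mat_rank_le_dim_row[of "H \<omega>"] dims by simp
    moreover have "vec_space.rank N' (H \<omega>) \<le> N''"
      by (rule vec_space.rank_le_nc[OF Hc])
    ultimately show ?case using dims by (simp add: m_def H_def)
  qed
qed

end
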